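(* Let $\mathbb{X},\mathbb{Y}$ be Euclidean spaces, $\Phi:\mathbb{X}\to\mathbb{Y}$ a linear operator, $f:\mathbb{Y}\to\mathbb{R}\cup\{\infty\}$ a proper lower semicontinuous convex function that is twice continuously differentiable on $\operatorname{int}(\operatorname{dom} f)$ with $\nabla^2 f(y)$ positive definite for all $y\in\operatorname{int}(\operatorname{dom} f)$, and $g:\mathbb{X}\to\mathbb{R}\cup\{\infty\}$ a proper lower semicontinuous convex function. Suppose that $\bar x\in\Phi^{-1}(\operatorname{int}(\operatorname{dom} f))\cap\operatorname{dom} g$ is an optimal solution of $$\min_{x\in\mathbb{X}}\ f(\Phi x)+g(x)$$ and that $g$ satisfies the quadratic growth condition at $\bar x$ for $\bar y:=-\Phi^*\nabla f(\Phi\bar x)$. Suppose further that the radial cone $\mathcal{R}_{\partial g^*(\bar y)}(\bar x)$ is closed. Then $\bar x$ is a strong solution of this problem if and only if it is a unique solution.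
   Context: $\Phi^*$ is the adjoint of $\Phi$; $\partial$ denotes the convex subdifferential; $g^*$ is the Legendre-Fenchel conjugate of $g$, so that $\partial g^*(\bar y)=\{x\in\mathbb{X}\mid \bar y\in\partial g(x)\}$. For a closed convex set $\Omega\subset\mathbb{X}$ and $\bar x\in\Omega$, the radial cone is $\mathcal{R}_\Omega(\bar x)=\mathbb{R}_+(\Omega-\bar x)$. $\mathbb{B}_\varepsilon(\bar x)$ is the open ball with center $\bar x$ and radius $\varepsilon$. Quadratic growth condition: a convex function $\varphi$ satisfies it at $\bar x\in\operatorname{dom}\varphi$ for $\bar v\in\partial\varphi(\bar x)$ if there exist $\varepsilon>0$ and $\kappa>0$ such that $\varphi(x)-\varphi(\bar x)-\langle\bar v,x-\bar x\rangle\ge\frac{\kappa}{2}\operatorname{dist}(x;\partial\varphi^*(\bar v))^2$ for all $x\in\mathbb{B}_\varepsilon(\bar x)$. Strong solution: $\bar x$ is a strong solution of $\min_{x\in\mathbb{X}}\varphi(x)$ if there exist $\varepsilon>0$ and $\kappa>0$ such that $\varphi(x)-\varphi(\bar x)\ge\frac{\kappa}{2}\|x-\bar x\|^2$ for all $x\in\mathbb{B}_\varepsilon(\bar x)$. *)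

theory Defs
  imports "HOL-Analysis.Analysis"
begin

definition effective_domain :: "('a \<Rightarrow> ereal) \<Rightarrow> 'a set" where
  "effective_domain \<phi> = {x. \<phi> x < \<infinity>}"

definition proper_fun :: "('a \<Rightarrow> ereal) \<Rightarrow> bool" where
  "proper_fun \<phi> \<longleftrightarrow> (\<forall>x. \<phi> x \<noteq> -\<infinity>) \<and> effective_domain \<phi> \<noteq> {}"

definition lsc_fun :: "('a::topological_space \<Rightarrow> ereal) \<Rightarrow> bool" where
  "lsc_fun \<phi> \<longleftrightarrow> (\<forall>x. \<phi> x \<le> Liminf (nhds x) \<phi>)"

(* Convexity through the epigraph, since convex_on and epigraph in the library are for
   real-valued functions. *)
definition convex_fun :: "('a::real_vector \<Rightarrow> ereal) \<Rightarrow> bool" where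
  "convex_fun \<phi> \<longleftrightarrow> convex {(x, r::real). \<phi> x \<le> ereal r}"

(* Empty where \<phi> is not finite. *)
definition subdifferential :: "('a::real_inner \<Rightarrow> ereal) \<Rightarrow> 'a \<Rightarrow> 'a set" where
  "subdifferential \<phi> x =
     {v. \<bar>\<phi> x\<bar> \<noteq> \<infinity> \<and> (\<forall>z. \<phi> x + ereal (v \<bullet> (z - x)) \<le> \<phi> z)}"

definition conjugate :: "('a::real_inner \<Rightarrow> ereal) \<Rightarrow> 'a \<Rightarrow> ereal" where
  "conjugate \<phi> v = (SUP x. ereal (v \<bullet> x) - \<phi> x)"

definition radial_cone :: "'a::real_vector set \<Rightarrow> 'a \<Rightarrow> 'a set" where
  "radial_cone \<Omega> x = {t *\<^sub>R (z - x) | t z. 0 \<le> t \<and> z \<in> \<Omega>}"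

(* Meant for v \<in> subdifferential \<phi> x. Then x itself lies in the set whose distance is taken,
   so the convention infdist z {} = 0 plays no role. *)
definition quadratic_growth :: "('a::real_inner \<Rightarrow> ereal) \<Rightarrow> 'a \<Rightarrow> 'a \<Rightarrow> bool" where
  "quadratic_growth \<phi> x v \<longleftrightarrow>
     (\<exists>\<epsilon>>0. \<exists>\<kappa>>0. \<forall>z\<in>ball x \<epsilon>.
        \<phi> z - \<phi> x - ereal (v \<bullet> (z - x))
          \<ge> ereal (\<kappa> / 2 * (infdist z (subdifferential (conjugate \<phi>) v))\<^sup>2))"

definition optimal_solution :: "('a \<Rightarrow> ereal) \<Rightarrow> 'a \<Rightarrow> bool" where
  "optimal_solution \<phi> x \<longleftrightarrow> is_arg_min \<phi> (\<lambda>_. True) x"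

definition unique_solution :: "('a \<Rightarrow> ereal) \<Rightarrow> 'a \<Rightarrow> bool" where
  "unique_solution \<phi> x \<longleftrightarrow>
     optimal_solution \<phi> x \<and> (\<forall>z. optimal_solution \<phi> z \<longrightarrow> z = x)"

definition strong_solution :: "('a::real_normed_vector \<Rightarrow> ereal) \<Rightarrow> 'a \<Rightarrow> bool" where
  "strong_solution \<phi> x \<longleftrightarrow>
     (\<exists>\<epsilon>>0. \<exists>\<kappa>>0. \<forall>z\<in>ball x \<epsilon>.
        \<phi> z - \<phi> x \<ge> ereal (\<kappa> / 2 * (norm (z - x))\<^sup>2))"

(* \<phi> is C^2 on S, with gradient df and Hessian d2f there (both are uniquely determined on S).
   For open S on which \<phi> is finite; real_of_ereal would hide infinite values. *)
definition C2_on ::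
  "('a::real_inner \<Rightarrow> ereal) \<Rightarrow> 'a set \<Rightarrow> ('a \<Rightarrow> 'a) \<Rightarrow> ('a \<Rightarrow> 'a \<Rightarrow>\<^sub>L 'a) \<Rightarrow> bool" where
  "C2_on \<phi> S df d2f \<longleftrightarrow>
     (\<forall>y\<in>S. GDERIV (\<lambda>z. real_of_ereal (\<phi> z)) y :> df y) \<and>
     (\<forall>y\<in>S. (df has_derivative blinfun_apply (d2f y)) (at y)) \<and>
     continuous_on S d2f"

end

theory Submission
  imports Defs
begin

text \<open>
  Write \<open>S\<close> for the subdifferential of the conjugate of \<open>g\<close> at \<open>yb\<close>. By Fenchel-Moreau, \<open>S\<close>
  is the set of minimisers of the tilted function \<open>z \<mapsto> g z - yb \<bullet> z\<close> (lemma
  \<open>subdifferential_conjugate_iff\<close>). Since \<open>yb\<close> is minus the gradient of \<open>f \<circ> \<Phi>\<close> at \<open>xb\<close>, the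
  linear terms of \<open>f \<circ> \<Phi>\<close> and of \<open>g\<close> cancel at \<open>xb\<close>. A positive definite Hessian of \<open>f\<close> and
  the quadratic growth of \<open>g\<close> then bound the growth of the objective near \<open>xb\<close> from below by a
  positive multiple of \<open>(norm (\<Phi> (z - xb)))\<^sup>2 + (infdist z S)\<^sup>2\<close>.

  This sum of squares controls \<open>(norm (z - xb))\<^sup>2\<close> as soon as \<open>xb\<close> is the only point of \<open>S\<close> in the
  fibre of \<open>\<Phi>\<close> through \<open>xb\<close>. Indeed, replacing \<open>S\<close> by \<open>xb\<close> plus its radial cone only decreases
  the distance and makes the expression homogeneous of degree two in \<open>z - xb\<close>. So it is enough
  that it is positive on the unit sphere, which is compact. This is where closedness of the
  radial cone enters: a unit vector at distance zero from the cone lies in the cone, hence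
  points from \<open>xb\<close> to a point of \<open>S\<close>; if \<open>\<Phi>\<close> annihilates it as well, that point is a second
  element of \<open>S\<close> in the fibre (lemma \<open>fibre_error_bound\<close>).

  Finally, all points of \<open>S\<close> in the fibre are optimal, because \<open>f \<circ> \<Phi>\<close> and the linear tilt
  take the same values there as at \<open>xb\<close>; so a unique solution satisfies the condition on the
  fibre and is therefore strong. Conversely, if there were a second solution, convexity would
  make the objective constant on a segment issuing from \<open>xb\<close>, against strong growth.
\<close>

section \<open>Extended-real convex functions and their conjugates\<close>

lemma convex_funD:
  assumes "convex_fun \<phi>" "\<phi> x \<le> ereal a" "\<phi> y \<le> ereal b" "0 \<le> t" "t \<le> 1"
  shows "\<phi> (x + t *\<^sub>R (y - x)) \<le> ereal (a + t * (b - a))"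
proof -
  have "(1 - t) *\<^sub>R (x, a) + t *\<^sub>R (y, b) \<in> {(x, r::real). \<phi> x \<le> ereal r}"
    using assms by (intro convexD) (auto simp: convex_fun_def)
  moreover have "(1 - t) *\<^sub>R (x, a) + t *\<^sub>R (y, b) = (x + t *\<^sub>R (y - x), a + t * (b - a))"
    by (simp add: algebra_simps)
  ultimately show ?thesis by simp
qed

lemma convex_fun_comp_linear_plus:
  assumes "linear \<Phi>" "convex_fun f" "convex_fun g"
    and f: "\<And>y. f y \<noteq> -\<infinity>" and g: "\<And>x. g x \<noteq> -\<infinity>"
  shows "convex_fun (\<lambda>x. f (\<Phi> x) + g x)"
  unfolding convex_fun_def
proof (rule convexI)
  fix P Q :: "'a \<times> real" and u v :: real
  assume PQ: "P \<in> {(x, r). f (\<Phi> x) + g x \<le> ereal r}" "Q \<in> {(x, r). f (\<Phi> x) + g x \<le> ereal r}"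
    and uv: "0 \<le> u" "0 \<le> v" "u + v = 1"
  obtain x a y b where P: "P = (x, a)" and Q: "Q = (y, b)"
    by (cases P, cases Q)
  have le: "f (\<Phi> x) + g x \<le> ereal a" "f (\<Phi> y) + g y \<le> ereal b"
    using PQ by (simp_all add: P Q)
  have split: "\<exists>p q. f (\<Phi> z) = ereal p \<and> g z = ereal q \<and> p + q \<le> c"
    if "f (\<Phi> z) + g z \<le> ereal c" for z c
    using that f[of "\<Phi> z"] g[of z] by (cases "f (\<Phi> z)"; cases "g z") auto
  obtain p q where x: "f (\<Phi> x) = ereal p" "g x = ereal q" "p + q \<le> a"
    using split[OF le(1)] by blast
  obtain p' q' where y: "f (\<Phi> y) = ereal p'" "g y = ereal q'" "p' + q' \<le> b"
    using split[OF le(2)] by blast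
  have u: "u = 1 - v" using uv by simp
  have w: "u *\<^sub>R x + v *\<^sub>R y = x + v *\<^sub>R (y - x)"
    by (simp add: u algebra_simps)
  have \<Phi>w: "\<Phi> (x + v *\<^sub>R (y - x)) = \<Phi> x + v *\<^sub>R (\<Phi> y - \<Phi> x)"
    using \<open>linear \<Phi>\<close> by (simp add: linear_add linear_scale linear_diff)
  have "f (\<Phi> x + v *\<^sub>R (\<Phi> y - \<Phi> x)) \<le> ereal (p + v * (p' - p))"
    using assms x y uv by (intro convex_funD) auto
  moreover have "g (x + v *\<^sub>R (y - x)) \<le> ereal (q + v * (q' - q))"
    using assms x y uv by (intro convex_funD) auto
  ultimately have "f (\<Phi> (u *\<^sub>R x + v *\<^sub>R y)) + g (u *\<^sub>R x + v *\<^sub>R y)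
      \<le> ereal (p + v * (p' - p)) + ereal (q + v * (q' - q))"
    unfolding w \<Phi>w by (rule add_mono)
  also have "\<dots> = ereal (u * (p + q) + v * (p' + q'))"
    by (simp add: u algebra_simps)
  also have "\<dots> \<le> ereal (u * a + v * b)"
    using x(3) y(3) uv by (simp add: add_mono mult_left_mono)
  finally show "u *\<^sub>R P + v *\<^sub>R Q \<in> {(x, r). f (\<Phi> x) + g x \<le> ereal r}"
    by (simp add: P Q)
qed

lemma closed_epigraph:
  assumes "lsc_fun \<phi>"
  shows "closed {(x, r::real). \<phi> x \<le> ereal r}"
proof -
  have "\<exists>U. open U \<and> (x, r) \<in> U \<and> U \<subseteq> - {(x, r::real). \<phi> x \<le> ereal r}"
    if lt: "ereal r < \<phi> x" for x r
  proof -
    obtain s where s: "ereal r < ereal s" "ereal s < \<phi> x"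
      using ereal_dense2[OF lt] by blast
    have "ereal s < Liminf (nhds x) \<phi>"
      using assms s(2) unfolding lsc_fun_def by (meson less_le_trans)
    then have "eventually (\<lambda>z. ereal s < \<phi> z) (nhds x)"
      by (rule less_LiminfD)
    then obtain V where V: "open V" "x \<in> V" "\<And>z. z \<in> V \<Longrightarrow> ereal s < \<phi> z"
      unfolding eventually_nhds by blast
    have "V \<times> {..<s} \<subseteq> - {(x, r::real). \<phi> x \<le> ereal r}"
    proof clarify
      fix z q assume "z \<in> V" "q < s" "\<phi> z \<le> ereal q"
      then show False
        using V(3)[of z] by (metis ereal_less_eq(3) less_le_not_le order_trans not_le)
    qed
    moreover have "open (V \<times> {..<s})" "(x, r) \<in> V \<times> {..<s}"
      using V s by (auto intro: open_Times)
    ultimately show ?thesis by blast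
  qed
  then show ?thesis
    unfolding closed_def by (subst open_subopen) (metis (no_types, lifting) ComplD case_prodI2 mem_Collect_eq not_le)
qed

text \<open>
  The inclusion that needs lower semicontinuity and convexity is an instance of Fenchel-Moreau.
  If \<open>x\<close> were not a minimiser of the function tilted by \<open>v\<close>, the point \<open>(x, v \<bullet> x - G)\<close>, with
  \<open>G\<close> the value of the conjugate at \<open>v\<close>, would lie strictly below the epigraph, and a
  hyperplane with normal \<open>(a, b)\<close> would separate the two. When \<open>b > 0\<close> the hyperplane is the
  graph of an affine function of slope \<open>- a /\<^sub>R b\<close>, but it may be vertical (\<open>b = 0\<close>). Adding the
  affine minorant of slope \<open>v\<close> to the separating inequality covers both cases at once: the
  slope \<open>w = (v - a) /\<^sub>R (1 + b)\<close> violates the subgradient inequality for the conjugate.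
\<close>

lemma subdifferential_conjugate_iff:
  fixes \<phi> :: "'a::euclidean_space \<Rightarrow> ereal"
  assumes proper: "proper_fun \<phi>" and "lsc_fun \<phi>" and "convex_fun \<phi>"
  shows "x \<in> subdifferential (conjugate \<phi>) v \<longleftrightarrow> v \<in> subdifferential \<phi> x"
proof
  assume v: "v \<in> subdifferential \<phi> x"
  then obtain p where p: "\<phi> x = ereal p" and sub: "\<And>z. \<phi> x + ereal (v \<bullet> (z - x)) \<le> \<phi> z"
    unfolding subdifferential_def by (cases "\<phi> x") auto
  have "conjugate \<phi> v \<le> ereal (v \<bullet> x - p)"
    unfolding conjugate_def
  proof (rule SUP_least)
    fix z show "ereal (v \<bullet> z) - \<phi> z \<le> ereal (v \<bullet> x - p)"
      using sub[of z] unfolding p by (cases "\<phi> z") (auto simp: algebra_simps)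
  qed
  moreover have ge: "ereal (w \<bullet> x - p) \<le> conjugate \<phi> w" for w
    unfolding conjugate_def by (rule SUP_upper2[of x]) (auto simp: p)
  ultimately have "conjugate \<phi> v = ereal (v \<bullet> x - p)"
    by (simp add: antisym)
  then show "x \<in> subdifferential (conjugate \<phi>) v"
    using ge by (auto simp: subdifferential_def inner_commute algebra_simps)
next
  assume "x \<in> subdifferential (conjugate \<phi>) v"
  then obtain G where G: "conjugate \<phi> v = ereal G"
    and sub: "\<And>w. ereal (G + x \<bullet> (w - v)) \<le> conjugate \<phi> w"
    unfolding subdifferential_def by (cases "conjugate \<phi> v") auto
  have no_minf: "\<phi> z \<noteq> -\<infinity>" for z
    using proper by (simp add: proper_fun_def)
  have young: "v \<bullet> z - s \<le> G" if "\<phi> z = ereal s" for z s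
  proof -
    have "ereal (v \<bullet> z) - \<phi> z \<le> conjugate \<phi> v"
      unfolding conjugate_def by (rule SUP_upper) simp
    then show ?thesis by (simp add: that G)
  qed
  define r where "r = v \<bullet> x - G"
  have "\<phi> x \<le> ereal r"
  proof (rule ccontr)
    assume "\<not> \<phi> x \<le> ereal r"
    define E where "E = {(z, s::real). \<phi> z \<le> ereal s}"
    have "closed E" "convex E"
      using closed_epigraph[OF assms(2)] assms(3) by (auto simp: E_def convex_fun_def)
    have "(x, r) \<notin> E"
      using \<open>\<not> \<phi> x \<le> ereal r\<close> by (simp add: E_def)
    obtain n c where n: "n \<bullet> (x, r) < c" "\<And>e. e \<in> E \<Longrightarrow> c < n \<bullet> e"
      using separating_hyperplane_closed_point[OF \<open>convex E\<close> \<open>closed E\<close> \<open>(x, r) \<notin> E\<close>] by blast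
    obtain a b where ab: "n = (a, b)" by (cases n)
    have below: "a \<bullet> x + b * r < c" and above: "\<And>z s. \<phi> z \<le> ereal s \<Longrightarrow> c < a \<bullet> z + b * s"
      using n by (auto simp: ab E_def)
    have "b \<ge> 0"
    proof (rule ccontr)
      assume "\<not> b \<ge> 0"
      obtain z s where z: "\<phi> z = ereal s"
      proof -
        obtain z where "\<phi> z < \<infinity>"
          using proper by (auto simp: proper_fun_def effective_domain_def)
        then show thesis using no_minf[of z] that by (cases "\<phi> z") auto
      qed
      define h where "h = max s ((c - a \<bullet> z) / b)"
      have "c < a \<bullet> z + b * h"
        by (rule above) (simp add: z h_def)
      moreover have "b * h \<le> b * ((c - a \<bullet> z) / b)"
        using \<open>\<not> b \<ge> 0\<close> by (intro mult_left_mono_neg) (auto simp: h_def)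
      ultimately show False
        using \<open>\<not> b \<ge> 0\<close> by simp
    qed
    define w where "w = (v - a) /\<^sub>R (1 + b)"
    have w: "(1 + b) * (w \<bullet> z) = v \<bullet> z - a \<bullet> z" for z
      using \<open>b \<ge> 0\<close> by (simp add: w_def inner_diff_left)
    have "conjugate \<phi> w \<le> ereal ((G - c) / (1 + b))"
      unfolding conjugate_def
    proof (rule SUP_least)
      fix z show "ereal (w \<bullet> z) - \<phi> z \<le> ereal ((G - c) / (1 + b))"
      proof (cases "\<phi> z")
        case (real s)
        have "(1 + b) * (w \<bullet> z - s) = v \<bullet> z - s - (a \<bullet> z + b * s)"
          using w[of z] by (simp add: algebra_simps)
        also have "\<dots> \<le> G - c"
          using young[OF real] above[of z s] real by simp
        finally show ?thesis
          using \<open>b \<ge> 0\<close> by (simp add: real field_simps)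
      qed (use no_minf[of z] in auto)
    qed
    then have "G + x \<bullet> (w - v) \<le> (G - c) / (1 + b)"
      using sub[of w] by (metis ereal_less_eq(3) order_trans)
    then have "(1 + b) * (G + x \<bullet> (w - v)) \<le> G - c"
      using \<open>b \<ge> 0\<close> by (simp add: field_simps)
    moreover have "(1 + b) * (G + x \<bullet> (w - v)) = G - (a \<bullet> x + b * r)"
      using w[of x] by (simp add: r_def inner_diff_right inner_commute algebra_simps)
    ultimately show False
      using below by simp
  qed
  then obtain p where p: "\<phi> x = ereal p" "p \<le> r"
    using no_minf[of x] by (cases "\<phi> x") auto
  have "\<phi> x + ereal (v \<bullet> (z - x)) \<le> \<phi> z" for z
  proof (cases "\<phi> z")
    case (real s)
    then show ?thesis
      using young[OF real] p by (simp add: r_def inner_diff_right)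
  qed (use no_minf[of z] in auto)
  then show "v \<in> subdifferential \<phi> x"
    by (simp add: subdifferential_def p)
qed

text \<open>
  A local minimum of a convex function, here of \<open>z \<mapsto> \<phi> z - v \<bullet> z\<close>, is a global one: the
  inequality at a point of the segment from \<open>x\<close> to \<open>z\<close> that lies close to \<open>x\<close> rescales to the
  inequality at \<open>z\<close>. So quadratic growth at \<open>x\<close> already contains the subgradient condition.
\<close>

lemma subdifferentialI_local:
  fixes \<phi> :: "'a::real_inner \<Rightarrow> ereal"
  assumes "convex_fun \<phi>" and x: "\<phi> x = ereal a" and "\<epsilon> > 0"
    and loc: "\<And>z. z \<in> ball x \<epsilon> \<Longrightarrow> \<phi> z - \<phi> x - ereal (v \<bullet> (z - x)) \<ge> 0"
  shows "v \<in> subdifferential \<phi> x"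
proof -
  have *: "a + v \<bullet> (z - x) \<le> b" if z: "\<phi> z \<le> ereal b" for z b
  proof -
    define t where "t = min 1 (\<epsilon> / (2 * (norm (z - x) + 1)))"
    have t: "0 < t" "t \<le> 1"
      using \<open>\<epsilon> > 0\<close> by (auto simp: t_def add_nonneg_pos)
    have "t * norm (z - x) \<le> \<epsilon> / (2 * (norm (z - x) + 1)) * norm (z - x)"
      by (intro mult_right_mono) (auto simp: t_def)
    also have "\<dots> < \<epsilon>"
      using \<open>\<epsilon> > 0\<close> by (simp add: divide_simps add_nonneg_pos)
    finally have "x + t *\<^sub>R (z - x) \<in> ball x \<epsilon>"
      using t by (simp add: dist_norm)
    from loc[OF this] have "ereal (a + t * (v \<bullet> (z - x))) \<le> \<phi> (x + t *\<^sub>R (z - x))"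
      by (cases "\<phi> (x + t *\<^sub>R (z - x))") (auto simp: x)
    also have "\<dots> \<le> ereal (a + t * (b - a))"
      using assms(1) x z t by (intro convex_funD) auto
    finally have "t * (v \<bullet> (z - x)) \<le> t * (b - a)"
      by simp
    then have "v \<bullet> (z - x) \<le> b - a"
      using t(1) by (rule mult_left_le_imp_le)
    then show ?thesis by simp
  qed
  have "\<phi> x + ereal (v \<bullet> (z - x)) \<le> \<phi> z" for z
    unfolding x plus_ereal.simps by (rule ereal_le_real) (simp add: *)
  then show ?thesis
    by (simp add: subdifferential_def x)
qed

section \<open>Lower bounds of second order\<close>

text \<open>
  Compactness of the unit sphere. Homogeneity is needed only as an inequality, whose instance
  \<open>t = 0\<close> says that \<open>q\<close> is nonnegative at the origin.
\<close>

lemma pos_homogeneous_lower_bound: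
  fixes q :: "'a::euclidean_space \<Rightarrow> real"
  assumes cont: "continuous_on (sphere 0 1) q"
    and pos: "\<And>u. norm u = 1 \<Longrightarrow> q u > 0"
    and hom: "\<And>t u. 0 \<le> t \<Longrightarrow> t\<^sup>2 * q u \<le> q (t *\<^sub>R u)"
  obtains c where "c > 0" "\<And>u. c * (norm u)\<^sup>2 \<le> q u"
proof -
  have "sphere (0::'a) 1 \<noteq> {}"
    by (simp add: sphere_eq_empty)
  then obtain m where m: "norm m = 1" "\<And>u. norm u = 1 \<Longrightarrow> q m \<le> q u"
    using continuous_attains_inf[OF compact_sphere _ cont] by auto
  have "q m * (norm u)\<^sup>2 \<le> q u" for u
  proof (cases "u = 0")
    case True
    then show ?thesis using hom[of 0 u] by simp
  next
    case False
    then have "q m * (norm u)\<^sup>2 \<le> (norm u)\<^sup>2 * q (u /\<^sub>R norm u)"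
      using m(2)[of "u /\<^sub>R norm u"] by (simp add: mult.commute mult_left_mono)
    also have "\<dots> \<le> q u"
      using hom[of "norm u" "u /\<^sub>R norm u"] False by simp
    finally show ?thesis .
  qed
  with pos[OF m(1)] show thesis by (rule that)
qed

text \<open>
  Second-order growth from a positive definite derivative of the gradient at the single point
  \<open>y0\<close>: by differentiability, the slope of \<open>f\<close> along a short segment from \<open>y0\<close> grows at least
  linearly with half the rate given by the Hessian, and integrating along the segment gives
  the bound.
\<close>

lemma growth_of_positive_definite_Hessian:
  fixes f :: "'a::euclidean_space \<Rightarrow> real"
  assumes "open S" "y0 \<in> S"
    and grad: "\<And>y. y \<in> S \<Longrightarrow> GDERIV f y :> df y"
    and hess: "(df has_derivative H) (at y0)"
    and pos: "\<And>h. h \<noteq> 0 \<Longrightarrow> h \<bullet> H h > 0"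
  obtains \<delta> \<mu> where "\<delta> > 0" "\<mu> > 0" "ball y0 \<delta> \<subseteq> S"
    "\<And>y. y \<in> ball y0 \<delta> \<Longrightarrow> f y0 + df y0 \<bullet> (y - y0) + \<mu> * (norm (y - y0))\<^sup>2 \<le> f y"
proof -
  have lin: "bounded_linear H"
    using hess by (rule has_derivative_bounded_linear)
  obtain m where m: "m > 0" "\<And>h. m * (norm h)\<^sup>2 \<le> h \<bullet> H h"
  proof (rule pos_homogeneous_lower_bound[of "\<lambda>h. h \<bullet> H h"])
    show "continuous_on (sphere 0 1) (\<lambda>h. h \<bullet> H h)"
      by (intro continuous_intros linear_continuous_on lin)
    show "t\<^sup>2 * (u \<bullet> H u) \<le> (t *\<^sub>R u) \<bullet> H (t *\<^sub>R u)" for t u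
      by (simp add: linear_scale[OF bounded_linear.linear[OF lin]] power2_eq_square)
    show "0 < u \<bullet> H u" if "norm u = 1" for u
      using that by (intro pos) auto
  qed (rule that)
  obtain d1 where d1: "d1 > 0"
    "\<And>y. norm (y - y0) < d1 \<Longrightarrow> norm (df y - df y0 - H (y - y0)) \<le> m / 2 * norm (y - y0)"
    using hess m(1) unfolding has_derivative_at_alt by (meson half_gt_zero)
  obtain d2 where d2: "d2 > 0" "ball y0 d2 \<subseteq> S"
    using \<open>open S\<close> \<open>y0 \<in> S\<close> openE by blast
  define \<delta> where "\<delta> = min d1 d2"
  have "f y0 + df y0 \<bullet> (y - y0) + m / 4 * (norm (y - y0))\<^sup>2 \<le> f y" if y: "y \<in> ball y0 \<delta>" for y
  proof -
    define h where "h = y - y0"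
    have h: "norm h < d1" "norm h < d2"
      using y by (auto simp: h_def \<delta>_def dist_norm norm_minus_commute)
    define \<psi> where "\<psi> t = f (y0 + t *\<^sub>R h) - t * (df y0 \<bullet> h) - m / 4 * t\<^sup>2 * (norm h)\<^sup>2" for t
    have "\<psi> 0 \<le> \<psi> 1"
    proof (rule DERIV_nonneg_imp_nondecreasing[of 0 1 \<psi>])
      fix t :: real assume t: "0 \<le> t" "t \<le> 1"
      have th: "norm (t *\<^sub>R h) \<le> norm h"
        using t by (simp add: mult_left_le_one_le)
      have "y0 + t *\<^sub>R h \<in> S"
        using th h d2(2) by (auto simp: dist_norm subset_iff)
      then have f': "(f has_derivative (\<lambda>k. df (y0 + t *\<^sub>R h) \<bullet> k)) (at (y0 + t *\<^sub>R h))"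
        using grad[of "y0 + t *\<^sub>R h"] by (simp add: gderiv_def inner_commute)
      have "((\<lambda>t. y0 + t *\<^sub>R h) has_derivative (\<lambda>s. s *\<^sub>R h)) (at t)"
        by (auto intro!: derivative_eq_intros)
      from has_derivative_compose[OF this f']
      have "((\<lambda>t. f (y0 + t *\<^sub>R h)) has_derivative (\<lambda>s. df (y0 + t *\<^sub>R h) \<bullet> (s *\<^sub>R h))) (at t)" .
      then have "((\<lambda>t. f (y0 + t *\<^sub>R h)) has_real_derivative df (y0 + t *\<^sub>R h) \<bullet> h) (at t)"
        by (simp add: has_field_derivative_def mult.commute[of _ "_ \<bullet> _"])
      then have "(\<psi> has_real_derivative
          df (y0 + t *\<^sub>R h) \<bullet> h - df y0 \<bullet> h - m / 2 * t * (norm h)\<^sup>2) (at t)"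
        unfolding \<psi>_def by (auto intro!: derivative_eq_intros)
      moreover have "0 \<le> df (y0 + t *\<^sub>R h) \<bullet> h - df y0 \<bullet> h - m / 2 * t * (norm h)\<^sup>2"
      proof -
        define e where "e = df (y0 + t *\<^sub>R h) - df y0 - t *\<^sub>R H h"
        have "norm e \<le> m / 2 * (t * norm h)"
          using d1(2)[of "y0 + t *\<^sub>R h"] th h t
          by (simp add: e_def linear_scale[OF bounded_linear.linear[OF lin]])
        then have "norm e * norm h \<le> m / 2 * (t * norm h) * norm h"
          by (rule mult_right_mono) simp
        moreover have "- (norm e * norm h) \<le> e \<bullet> h"
          using Cauchy_Schwarz_ineq2[of e h] by linarith
        moreover have "t * (m * (norm h)\<^sup>2) \<le> t * (h \<bullet> H h)"
          using m(2) t by (intro mult_left_mono) auto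
        moreover have "e \<bullet> h = df (y0 + t *\<^sub>R h) \<bullet> h - df y0 \<bullet> h - t * (h \<bullet> H h)"
          by (simp add: e_def inner_diff_left inner_diff_right inner_commute)
        ultimately show ?thesis
          by (simp add: power2_eq_square algebra_simps)
      qed
      ultimately show "\<exists>D. DERIV \<psi> t :> D \<and> 0 \<le> D" by blast
    qed simp
    then show ?thesis
      by (simp add: \<psi>_def h_def)
  qed
  then show thesis
    using d1 d2 m(1) by (intro that[of \<delta> "m / 4"]) (auto simp: \<delta>_def)
qed

section \<open>A global error bound from a closed radial cone\<close>

lemma radial_cone_scale:
  assumes "d \<in> radial_cone S x" "0 \<le> t"
  shows "t *\<^sub>R d \<in> radial_cone S x"
proof -
  obtain r s where "d = r *\<^sub>R (s - x)" "0 \<le> r" "s \<in> S"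
    using assms(1) unfolding radial_cone_def by blast
  then have "t *\<^sub>R d = (t * r) *\<^sub>R (s - x)" "0 \<le> t * r" "s \<in> S"
    using assms(2) by auto
  then show ?thesis
    unfolding radial_cone_def by blast
qed

lemma infdist_radial_cone_le_infdist:
  fixes x :: "'a::real_normed_vector"
  assumes "S \<noteq> {}"
  shows "infdist (z - x) (radial_cone S x) \<le> infdist z S"
proof -
  have "infdist (z - x) (radial_cone S x) \<le> dist z s" if "s \<in> S" for s
  proof -
    have "s - x = 1 *\<^sub>R (s - x)" by simp
    then have "s - x \<in> radial_cone S x"
      using that unfolding radial_cone_def by fastforce
    then have "infdist (z - x) (radial_cone S x) \<le> dist (z - x) (s - x)"
      by (rule infdist_le)
    then show ?thesis by (simp add: dist_norm)
  qed
  then show ?thesis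
    unfolding infdist_notempty[OF assms] using assms by (intro cINF_greatest) auto
qed

lemma scale_infdist_radial_cone_le:
  fixes x :: "'a::real_normed_vector"
  assumes "0 \<le> t"
  shows "t * infdist d (radial_cone S x) \<le> infdist (t *\<^sub>R d) (radial_cone S x)"
proof (cases "t = 0 \<or> radial_cone S x = {}")
  case True
  then show ?thesis
  proof
    assume "t = 0"
    then show ?thesis by (simp add: infdist_nonneg )
  qed (simp add: infdist_def)
next
  case False
  then have t: "t > 0" using assms by simp
  have "t * infdist d (radial_cone S x) \<le> dist (t *\<^sub>R d) k" if "k \<in> radial_cone S x" for k
  proof -
    have "k /\<^sub>R t \<in> radial_cone S x"
      using that t by (intro radial_cone_scale) auto
    then have "t * infdist d (radial_cone S x) \<le> t * dist d (k /\<^sub>R t)"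
      using t by (simp add: infdist_le)
    also have "\<dots> = norm (t *\<^sub>R (d - k /\<^sub>R t))"
      using t by (simp add: dist_norm)
    also have "\<dots> = dist (t *\<^sub>R d) k"
      using t by (simp add: dist_norm scaleR_diff_right)
    finally show ?thesis .
  qed
  then show ?thesis
    using False by (simp add: infdist_notempty cINF_greatest)
qed

text \<open>
  The homogeneous function is \<open>d \<mapsto> (norm (\<Phi> d))\<^sup>2 + (infdist d K)\<^sup>2\<close> for the radial cone \<open>K\<close>. Its
  zeros are exactly the elements of \<open>K\<close> in the kernel of \<open>\<Phi>\<close>, because \<open>K\<close> is closed, and each
  nonzero one is a positive multiple of some \<open>s - x\<close> with \<open>s \<in> S\<close> and \<open>\<Phi> s = \<Phi> x\<close>.
\<close>

lemma fibre_error_bound: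
  fixes \<Phi> :: "'a::euclidean_space \<Rightarrow> 'b::euclidean_space"
  assumes "linear \<Phi>" "x \<in> S" "closed (radial_cone S x)"
    and fibre: "\<And>s. s \<in> S \<Longrightarrow> \<Phi> s = \<Phi> x \<Longrightarrow> s = x"
  obtains c where "c > 0"
    "\<And>z. c * (norm (z - x))\<^sup>2 \<le> (norm (\<Phi> (z - x)))\<^sup>2 + (infdist z S)\<^sup>2"
proof -
  define K where "K = radial_cone S x"
  have K: "closed K" "K \<noteq> {}"
    using assms by (auto simp: K_def radial_cone_def)
  obtain c where c: "c > 0" "\<And>d. c * (norm d)\<^sup>2 \<le> (norm (\<Phi> d))\<^sup>2 + (infdist d K)\<^sup>2"
  proof (rule pos_homogeneous_lower_bound[of "\<lambda>d. (norm (\<Phi> d))\<^sup>2 + (infdist d K)\<^sup>2"])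
    show "continuous_on (sphere 0 1) (\<lambda>d. (norm (\<Phi> d))\<^sup>2 + (infdist d K)\<^sup>2)"
      using \<open>linear \<Phi>\<close> by (intro continuous_intros linear_continuous_on)
        (simp add: linear_conv_bounded_linear)
    fix d :: 'a assume d: "norm d = 1"
    show "0 < (norm (\<Phi> d))\<^sup>2 + (infdist d K)\<^sup>2"
    proof (rule ccontr)
      assume "\<not> 0 < (norm (\<Phi> d))\<^sup>2 + (infdist d K)\<^sup>2"
      then have "\<Phi> d = 0" "infdist d K = 0"
        by (auto simp: not_less sum_power2_le_zero_iff)
      then have "d \<in> K"
        using K in_closed_iff_infdist_zero by blast
      then obtain t s where s: "d = t *\<^sub>R (s - x)" "s \<in> S"
        unfolding K_def radial_cone_def by blast
      have "t \<noteq> 0" "s \<noteq> x"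
        using d s by auto
      moreover have "t *\<^sub>R (\<Phi> s - \<Phi> x) = 0"
        using \<open>\<Phi> d = 0\<close> \<open>linear \<Phi>\<close> by (simp add: s linear_scale linear_diff)
      ultimately show False
        using fibre[OF s(2)] by simp
    qed
  next
    fix t :: real and d :: 'a assume t: "0 \<le> t"
    have "(t * infdist d K)\<^sup>2 \<le> (infdist (t *\<^sub>R d) K)\<^sup>2"
      unfolding K_def using t
      by (intro power_mono scale_infdist_radial_cone_le) (auto simp: infdist_nonneg)
    then show "t\<^sup>2 * ((norm (\<Phi> d))\<^sup>2 + (infdist d K)\<^sup>2)
        \<le> (norm (\<Phi> (t *\<^sub>R d)))\<^sup>2 + (infdist (t *\<^sub>R d) K)\<^sup>2"
      using \<open>linear \<Phi>\<close> by (simp add: linear_scale power_mult_distrib algebra_simps)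
  qed (rule that)
  have "c * (norm (z - x))\<^sup>2 \<le> (norm (\<Phi> (z - x)))\<^sup>2 + (infdist z S)\<^sup>2" for z
  proof -
    have "(infdist (z - x) K)\<^sup>2 \<le> (infdist z S)\<^sup>2"
      unfolding K_def using \<open>x \<in> S\<close>
      by (intro power_mono infdist_radial_cone_le_infdist) (auto simp: infdist_nonneg)
    then show ?thesis using c(2)[of "z - x"] by linarith
  qed
  with c(1) show thesis by (rule that)
qed

section \<open>Strong and unique solutions\<close>

lemma strong_solution_imp_unique_solution:
  fixes F :: "'a::real_normed_vector \<Rightarrow> ereal"
  assumes "convex_fun F" and x: "F x = ereal a" and opt: "optimal_solution F x"
    and strong: "strong_solution F x"
  shows "unique_solution F x"
proof -
  have "z = x" if z: "optimal_solution F z" for z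
  proof (rule ccontr)
    assume "z \<noteq> x"
    have "F z = F x"
      using opt z by (metis is_arg_min_linorder optimal_solution_def antisym)
    obtain \<epsilon> \<kappa> where "\<epsilon> > 0" "\<kappa> > 0"
      and grow: "\<And>w. w \<in> ball x \<epsilon> \<Longrightarrow> F w - F x \<ge> ereal (\<kappa> / 2 * (norm (w - x))\<^sup>2)"
      using strong unfolding strong_solution_def by blast
    define t where "t = min 1 (\<epsilon> / (2 * norm (z - x)))"
    define w where "w = x + t *\<^sub>R (z - x)"
    have t: "0 < t" "t \<le> 1"
      using \<open>\<epsilon> > 0\<close> \<open>z \<noteq> x\<close> by (auto simp: t_def)
    have "t * norm (z - x) \<le> \<epsilon> / (2 * norm (z - x)) * norm (z - x)"
      by (intro mult_right_mono) (auto simp: t_def)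
    then have "norm (w - x) < \<epsilon>"
      using t \<open>\<epsilon> > 0\<close> \<open>z \<noteq> x\<close> by (simp add: w_def)
    then have "F w - F x \<ge> ereal (\<kappa> / 2 * (norm (w - x))\<^sup>2)"
      by (intro grow) (simp add: dist_norm norm_minus_commute)
    moreover have "F w \<le> ereal (a + t * (a - a))"
      unfolding w_def using assms(1) x \<open>F z = F x\<close> t by (intro convex_funD) auto
    moreover have "\<kappa> / 2 * (norm (w - x))\<^sup>2 > 0"
      using \<open>\<kappa> > 0\<close> \<open>z \<noteq> x\<close> t by (simp add: w_def)
    ultimately show False
      by (cases "F w") (auto simp: x)
  qed
  then show ?thesis
    using opt unfolding unique_solution_def by blast
qed

theorem corollary3p2:
  fixes \<Phi> :: "'x::euclidean_space \<Rightarrow> 'y::euclidean_space"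
    and f :: "'y \<Rightarrow> ereal"
    and g :: "'x \<Rightarrow> ereal"
    and df :: "'y \<Rightarrow> 'y"
    and d2f :: "'y \<Rightarrow> 'y \<Rightarrow>\<^sub>L 'y"
    and xb yb :: 'x
  assumes "linear \<Phi>"
    and "proper_fun f" and "lsc_fun f" and "convex_fun f"
    and "C2_on f (interior (effective_domain f)) df d2f"
    and "\<And>y h. y \<in> interior (effective_domain f) \<Longrightarrow> h \<noteq> 0 \<Longrightarrow> h \<bullet> blinfun_apply (d2f y) h > 0"
    and "proper_fun g" and "lsc_fun g" and "convex_fun g"
    and "\<Phi> xb \<in> interior (effective_domain f)" and "xb \<in> effective_domain g"
    and "optimal_solution (\<lambda>x. f (\<Phi> x) + g x) xb"
    and "yb = - adjoint \<Phi> (df (\<Phi> xb))"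
    and "quadratic_growth g xb yb"
    and "closed (radial_cone (subdifferential (conjugate g) yb) xb)"
  shows "strong_solution (\<lambda>x. f (\<Phi> x) + g x) xb \<longleftrightarrow> unique_solution (\<lambda>x. f (\<Phi> x) + g x) xb"
proof -
  note lin = assms(1)
  let ?F = "\<lambda>x. f (\<Phi> x) + g x"
  let ?S = "subdifferential (conjugate g) yb"
  let ?D = "interior (effective_domain f)"
  have f_no_minf: "f y \<noteq> -\<infinity>" for y
    using assms(2) by (simp add: proper_fun_def)
  have g_no_minf: "g x \<noteq> -\<infinity>" for x
    using assms(7) by (simp add: proper_fun_def)
  have f_fin: "f y = ereal (real_of_ereal (f y))" if "y \<in> ?D" for y
    using that interior_subset[of "effective_domain f"] f_no_minf[of y]
    by (cases "f y") (auto simp: effective_domain_def)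
  obtain p where p: "f (\<Phi> xb) = ereal p"
    using f_fin[OF assms(10)] by blast
  obtain q where q: "g xb = ereal q"
    using assms(11) g_no_minf[of xb] by (cases "g xb") (auto simp: effective_domain_def)

  obtain \<epsilon> \<kappa> where \<epsilon>\<kappa>: "\<epsilon> > 0" "\<kappa> > 0"
    and grow_g: "\<And>z. z \<in> ball xb \<epsilon> \<Longrightarrow>
      g z - g xb - ereal (yb \<bullet> (z - xb)) \<ge> ereal (\<kappa> / 2 * (infdist z ?S)\<^sup>2)"
    using assms(14) unfolding quadratic_growth_def by blast
  have S_iff: "x \<in> ?S \<longleftrightarrow> yb \<in> subdifferential g x" for x
    by (rule subdifferential_conjugate_iff) (use assms in auto)
  have sub_xb: "yb \<in> subdifferential g xb"
  proof (rule subdifferentialI_local[OF assms(9) q \<epsilon>\<kappa>(1)])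
    fix z assume "z \<in> ball xb \<epsilon>"
    have "(0::ereal) \<le> ereal (\<kappa> / 2 * (infdist z ?S)\<^sup>2)"
      using \<epsilon>\<kappa>(2) by simp
    also have "\<dots> \<le> g z - g xb - ereal (yb \<bullet> (z - xb))"
      by (rule grow_g) fact
    finally show "0 \<le> g z - g xb - ereal (yb \<bullet> (z - xb))" .
  qed
  then have xb_S: "xb \<in> ?S"
    by (simp add: S_iff)
  \<comment> \<open>The tilt of \<open>g\<close> cancels the linear term of \<open>f \<circ> \<Phi>\<close>.\<close>
  have yb: "yb \<bullet> d = - (df (\<Phi> xb) \<bullet> \<Phi> d)" for d
    using adjoint_works[OF lin, of d "df (\<Phi> xb)"] assms(13) by (simp add: inner_commute)

  show ?thesis
  proof
    assume "strong_solution ?F xb"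
    moreover have "convex_fun ?F"
      using assms f_no_minf g_no_minf by (intro convex_fun_comp_linear_plus) auto
    ultimately show "unique_solution ?F xb"
      using assms(12) p q by (intro strong_solution_imp_unique_solution[where a = "p + q"]) auto
  next
    assume uniq: "unique_solution ?F xb"
    have fibre: "s = xb" if s: "s \<in> ?S" "\<Phi> s = \<Phi> xb" for s
    proof -
      have "g s + ereal (yb \<bullet> (xb - s)) \<le> g xb"
        using s(1) unfolding S_iff by (simp add: subdifferential_def)
      moreover have "yb \<bullet> (xb - s) = 0"
        using s(2) lin by (simp add: yb linear_diff)
      ultimately have "g s \<le> g xb" by simp
      then have "?F s \<le> ?F xb"
        by (simp add: s(2) add_left_mono)
      then have "optimal_solution ?F s"
        using assms(12) unfolding optimal_solution_def is_arg_min_linorder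
        by (meson order_trans)
      then show ?thesis
        using uniq unfolding unique_solution_def by blast
    qed
    obtain c where c: "c > 0"
      "\<And>z. c * (norm (z - xb))\<^sup>2 \<le> (norm (\<Phi> (z - xb)))\<^sup>2 + (infdist z ?S)\<^sup>2"
      using fibre_error_bound[OF lin xb_S assms(15) fibre] by blast
    obtain \<delta> \<mu> where \<delta>\<mu>: "\<delta> > 0" "\<mu> > 0" "ball (\<Phi> xb) \<delta> \<subseteq> ?D"
      and grow_f: "\<And>y. y \<in> ball (\<Phi> xb) \<delta> \<Longrightarrow>
        real_of_ereal (f (\<Phi> xb)) + df (\<Phi> xb) \<bullet> (y - \<Phi> xb) + \<mu> * (norm (y - \<Phi> xb))\<^sup>2
          \<le> real_of_ereal (f y)"
    proof (rule growth_of_positive_definite_Hessian[OF open_interior assms(10)])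
      show "GDERIV (\<lambda>y. real_of_ereal (f y)) y :> df y" if "y \<in> ?D" for y
        using assms(5) that by (simp add: C2_on_def)
      show "(df has_derivative blinfun_apply (d2f (\<Phi> xb))) (at (\<Phi> xb))"
        using assms(5,10) by (simp add: C2_on_def)
    qed (use assms(6,10) in auto)
    have "isCont \<Phi> xb"
      using lin by (simp add: linear_continuous_at linear_conv_bounded_linear)
    then obtain \<eta> where \<eta>: "\<eta> > 0" "\<And>z. dist z xb < \<eta> \<Longrightarrow> dist (\<Phi> z) (\<Phi> xb) < \<delta>"
      using \<delta>\<mu>(1) unfolding continuous_at_eps_delta by blast
    define m where "m = min \<mu> (\<kappa> / 2)"
    have m: "m > 0" "m \<le> \<mu>" "m \<le> \<kappa> / 2"
      using \<delta>\<mu> \<epsilon>\<kappa> by (auto simp: m_def)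
    have "?F z - ?F xb \<ge> ereal ((2 * m * c) / 2 * (norm (z - xb))\<^sup>2)"
      if z: "z \<in> ball xb (min \<epsilon> \<eta>)" for z
    proof (cases "g z")
      case (real b)
      have \<Phi>z: "\<Phi> z \<in> ball (\<Phi> xb) \<delta>"
        using z \<eta>(2)[of z] by (simp add: dist_commute)
      then obtain a where a: "f (\<Phi> z) = ereal a"
        using f_fin \<delta>\<mu>(3) by blast
      have diff: "\<Phi> z - \<Phi> xb = \<Phi> (z - xb)"
        using lin by (simp add: linear_diff)
      have "p + df (\<Phi> xb) \<bullet> \<Phi> (z - xb) + \<mu> * (norm (\<Phi> (z - xb)))\<^sup>2 \<le> a"
        using grow_f[OF \<Phi>z] by (simp add: a p diff)
      moreover have "b - q + df (\<Phi> xb) \<bullet> \<Phi> (z - xb) \<ge> \<kappa> / 2 * (infdist z ?S)\<^sup>2"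
        using grow_g[of z] z by (simp add: real q yb)
      moreover have "m * (norm (\<Phi> (z - xb)))\<^sup>2 \<le> \<mu> * (norm (\<Phi> (z - xb)))\<^sup>2"
        "m * (infdist z ?S)\<^sup>2 \<le> \<kappa> / 2 * (infdist z ?S)\<^sup>2"
        by (rule mult_right_mono, use m in simp, simp)+
      moreover have "m * (c * (norm (z - xb))\<^sup>2)
          \<le> m * (norm (\<Phi> (z - xb)))\<^sup>2 + m * (infdist z ?S)\<^sup>2"
        using mult_left_mono[OF c(2)[of z], of m] m by (simp add: distrib_left)
      ultimately have "m * (c * (norm (z - xb))\<^sup>2) \<le> (a + b) - (p + q)"
        by linarith
      then show ?thesis
        by (simp add: a real p q mult.assoc)
    qed (use g_no_minf[of z] f_no_minf[of "\<Phi> z"] p q in auto)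
    then show "strong_solution ?F xb"
      unfolding strong_solution_def using \<epsilon>\<kappa>(1) \<eta>(1) m(1) c(1)
      by (intro exI[of _ "min \<epsilon> \<eta>"] exI[of _ "2 * m * c"] conjI) auto
  qed
qed

end
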